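(* Let $G$ be a connected unicyclic graph whose only cycle is $C_p$. If $e$ is an edge of $C_p$, then $\gamma_{\rm wcon}(G)-2\leq\gamma_{\rm wcon}(G-e)\leq\gamma_{\rm wcon}(G)+2$.
   Context: Graphs are finite, simple, undirected. A unicyclic graph is a connected graph containing exactly one cycle. A set $D$ is dominating if every vertex outside $D$ has a neighbour in $D$; weakly convex if for any $a,b\in D$ some shortest $(a-b)$-path in the graph lies in $D$. $\gamma_{\rm wcon}$ denotes the minimum size of a weakly convex dominating set. *)

theory Defs
  imports "Graph_Theory.Graph_Theory"
begin

text \<open>
  A finite simple undirected graph is a \<^locale>\<open>pair_graph\<close>: a finite, loop-free, symmetric
  digraph. The undirected edge joining \<open>u\<close> and \<open>v\<close> is the pair of arcs \<open>(u, v)\<close> and \<open>(v, u)\<close>.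
\<close>

definition delete_edge :: "'a pair_pre_digraph \<Rightarrow> 'a \<times> 'a \<Rightarrow> 'a pair_pre_digraph" where
  "delete_edge G e =
     \<lparr> pverts = pverts G, parcs = parcs G - {(fst e, snd e), (snd e, fst e)} \<rparr>"

text \<open>
  Cycles are taken as subgraphs, so that the closed walks which differ only in starting point or
  orientation all give the same cycle. The condition on the length excludes the closed walks
  \<open>u, v, u\<close>, which \<^const>\<open>pre_digraph.cycle\<close> admits in a symmetric digraph. \<open>(set c)\<^sup>s\<close> is the
  symmetric closure.
\<close>

definition cycle_of :: "'a pair_pre_digraph \<Rightarrow> 'a pair_pre_digraph \<Rightarrow> bool" where
  "cycle_of G C \<longleftrightarrow>
     (\<exists>c. pre_digraph.cycle (with_proj G) c \<and> 3 \<le> length c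
        \<and> C = \<lparr> pverts = fst ` set c, parcs = (set c)\<^sup>s \<rparr>)"

definition unicyclic :: "'a pair_pre_digraph \<Rightarrow> bool" where
  "unicyclic G \<longleftrightarrow> connected (with_proj G) \<and> (\<exists>!C. cycle_of G C)"

definition shortest_path :: "'a pair_pre_digraph \<Rightarrow> 'a \<Rightarrow> ('a \<times> 'a) awalk \<Rightarrow> 'a \<Rightarrow> bool" where
  "shortest_path G a p b \<longleftrightarrow>
     pre_digraph.apath (with_proj G) a p b
     \<and> (\<forall>q. pre_digraph.apath (with_proj G) a q b \<longrightarrow> length p \<le> length q)"

definition dominating :: "'a pair_pre_digraph \<Rightarrow> 'a set \<Rightarrow> bool" where
  "dominating G D \<longleftrightarrow>
     D \<subseteq> pverts G \<and> (\<forall>v \<in> pverts G - D. \<exists>d \<in> D. (v, d) \<in> parcs G)"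

definition weakly_convex :: "'a pair_pre_digraph \<Rightarrow> 'a set \<Rightarrow> bool" where
  "weakly_convex G D \<longleftrightarrow>
     D \<subseteq> pverts G
     \<and> (\<forall>a \<in> D. \<forall>b \<in> D. \<exists>p. shortest_path G a p b \<and> set (pawalk_verts a p) \<subseteq> D)"

text \<open>
  The minimum is over a nonempty set whenever \<open>G\<close> is connected, since then all of
  \<^term>\<open>pverts G\<close> is weakly convex and dominating.
\<close>

definition gamma_wcon :: "'a pair_pre_digraph \<Rightarrow> nat" (\<open>\<gamma>\<^sub>w\<^sub>c\<^sub>o\<^sub>n\<close>) where
  "\<gamma>\<^sub>w\<^sub>c\<^sub>o\<^sub>n G = (LEAST n. \<exists>D. weakly_convex G D \<and> dominating G D \<and> card D = n)"

end

(*
  Let V be the vertex set of the cycle. Call a set X connected if any two of its vertices are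
  joined by a path inside X. If X is connected and contains V, then every path between vertices of
  X stays in X, as otherwise there would be a second cycle; hence X is weakly convex, both in G and
  in G - e. If D is a connected dominating set, then D and V together form a connected set, and at
  most two vertices of V are missing from D: if more than one is missing, D meets V in an arc of the
  cycle, and every missing vertex is one of the two neighbours of this arc. So adding V to a minimum weakly convex
  dominating set of either graph gives one of the other with at most two more vertices.
*)

theory Submission
  imports Defs
begin

section \<open>Connected vertex sets\<close>

text \<open>Stated for a relation so that it applies alike to the arcs of G, to those of G - e and
  to the symmetrised arcs of the cycle.\<close>

definition connected_in :: "'a rel \<Rightarrow> 'a set \<Rightarrow> bool" where
  "connected_in R X \<longleftrightarrow> (\<forall>a \<in> X. \<forall>b \<in> X. (a, b) \<in> (R \<inter> X \<times> X)\<^sup>*)"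

lemma connected_inD: "connected_in R X \<Longrightarrow> a \<in> X \<Longrightarrow> b \<in> X \<Longrightarrow> (a, b) \<in> (R \<inter> X \<times> X)\<^sup>*"
  by (simp add: connected_in_def)

lemma rtrancl_restrict_mono:
  assumes "(a, b) \<in> (R \<inter> X \<times> X)\<^sup>*" and "R \<inter> X \<times> X \<subseteq> S" and "X \<subseteq> Y"
  shows "(a, b) \<in> (S \<inter> Y \<times> Y)\<^sup>*"
proof -
  have "R \<inter> X \<times> X \<subseteq> S \<inter> Y \<times> Y"
    using assms(2,3) by blast
  then show ?thesis
    using assms(1) rtrancl_mono by blast
qed

lemma connected_in_mono:
  assumes "connected_in R X" and "R \<inter> X \<times> X \<subseteq> S"
  shows "connected_in S X"
  using rtrancl_restrict_mono[OF connected_inD[OF assms(1)] assms(2) order_refl]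
  by (simp add: connected_in_def)

lemma connected_inI_base:
  assumes "sym R" and "\<And>a. a \<in> X \<Longrightarrow> (v, a) \<in> (R \<inter> X \<times> X)\<^sup>*"
  shows "connected_in R X"
proof -
  have "sym ((R \<inter> X \<times> X)\<^sup>*)"
    using assms(1) by (intro sym_rtrancl) (auto simp: sym_def)
  then show ?thesis
    using assms(2) unfolding connected_in_def by (meson rtrancl_trans symD)
qed

lemma connected_in_Un:
  assumes "sym R" and X: "connected_in R X" and Y: "connected_in R Y"
    and "x \<in> X" and "y \<in> Y" and "(x, y) \<in> R"
  shows "connected_in R (X \<union> Y)"
proof (rule connected_inI_base[OF \<open>sym R\<close>])
  let ?S = "(R \<inter> (X \<union> Y) \<times> (X \<union> Y))\<^sup>*"
  fix a assume "a \<in> X \<union> Y"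
  then show "(x, a) \<in> ?S"
  proof
    assume "a \<in> X"
    show ?thesis
      by (rule rtrancl_restrict_mono[OF connected_inD[OF X \<open>x \<in> X\<close> \<open>a \<in> X\<close>]]) auto
  next
    assume "a \<in> Y"
    have "(y, a) \<in> ?S"
      by (rule rtrancl_restrict_mono[OF connected_inD[OF Y \<open>y \<in> Y\<close> \<open>a \<in> Y\<close>]]) auto
    moreover have "(x, y) \<in> R \<inter> (X \<union> Y) \<times> (X \<union> Y)"
      using assms by blast
    ultimately show ?thesis
      by (rule converse_rtrancl_into_rtrancl[rotated])
  qed
qed

text \<open>
  Everything reachable inside \<open>X\<close> from an exit \<open>x\<close> is reached by walking backwards along \<open>r\<close>, so
  no other reachable vertex can be an exit.
\<close>

lemma exit_unique:
  assumes r: "single_valued r" "single_valued (r\<inverse>)" and conn: "connected_in (r\<^sup>s) X"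
    and x: "x \<in> X" "(x, w) \<in> r" "w \<notin> X"
    and x': "x' \<in> X" "(x', w') \<in> r" "w' \<notin> X"
  shows "w = w'"
proof -
  let ?B = "r \<inter> X \<times> X"
  have "(x, x') \<in> (r\<^sup>s \<inter> X \<times> X)\<^sup>*"
    using conn x(1) x'(1) by (rule connected_inD)
  then have "(x', x) \<in> ?B\<^sup>*"
  proof (induction rule: rtrancl_induct)
    case (step y z)
    then consider "(z, y) \<in> ?B" | "(y, z) \<in> ?B"
      by (auto simp: symcl_def)
    then show ?case
    proof cases
      case 1
      then show ?thesis
        using step.IH by (rule converse_rtrancl_into_rtrancl)
    next
      case 2
      \<comment> \<open>The only \<open>r\<close>-successor of \<open>x\<close> is \<open>w\<close>
        outside \<open>X\<close>, whereas \<open>z\<close> is in \<open>X\<close>. So the chain from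
        \<open>y\<close> to \<open>x\<close> is nonempty, and its first arc must be
        \<open>(y, z)\<close>.\<close>
      have "y \<noteq> x"
        using 2 x r(1) by (auto dest: single_valuedD)
      then obtain y' where "(y, y') \<in> ?B" "(y', x) \<in> ?B\<^sup>*"
        using step.IH by (meson converse_rtranclE)
      then show ?thesis
        using 2 r(1) by (auto dest: single_valuedD)
    qed
  qed simp
  \<comment> \<open>A nonempty chain inside \<open>X\<close> would start with the only arc out of
    \<open>x'\<close>, which ends at \<open>w'\<close> outside \<open>X\<close>.\<close>
  then have "x' = x"
    by (rule converse_rtranclE) (use x' r(1) in \<open>auto dest: single_valuedD\<close>)
  then show ?thesis
    using x x' r(1) by (auto dest: single_valuedD)
qed

lemma parcs_delete_edge: "parcs (delete_edge G e) \<subseteq> parcs G"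
  by (auto simp: delete_edge_def)

lemma delete_edge_swap: "delete_edge G (u, v) = delete_edge G (v, u)"
  by (auto simp: delete_edge_def)

lemma symcl_converse: "(r\<inverse>)\<^sup>s = r\<^sup>s"
  by (force simp: symcl_def)

section \<open>Walks, paths and cycles\<close>

context pair_wf_digraph
begin

lemma rtrancl_restrict_awalk:
  assumes "awalk a p b" and "set p \<subseteq> R" and "set (pawalk_verts a p) \<subseteq> X"
  shows "(a, b) \<in> (R \<inter> X \<times> X)\<^sup>*"
  using assms
proof (induction p arbitrary: a)
  case (Cons e p)
  have "snd e \<in> set (pawalk_verts (snd e) p)"
    using Cons.prems(1) by (auto simp: awalk_Cons_iff intro: hd_in_awalk_verts)
  then have "(a, snd e) \<in> R \<inter> X \<times> X"
    using Cons.prems by (cases e) (auto simp: awalk_Cons_iff)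
  moreover have "(snd e, b) \<in> (R \<inter> X \<times> X)\<^sup>*"
    using Cons.prems by (intro Cons.IH) (auto simp: awalk_Cons_iff)
  ultimately show ?case
    by (rule converse_rtrancl_into_rtrancl)
qed (auto simp: awalk_Nil_iff)

text \<open>A chain of arcs inside \<open>X\<close> is a walk, and cutting a walk down to a path
  adds no vertices.\<close>

lemma ex_apath_restrict:
  assumes "(a, b) \<in> (parcs G \<inter> X \<times> X)\<^sup>*" and "a \<in> X" and "a \<in> pverts G"
  shows "\<exists>p. apath a p b \<and> set (pawalk_verts a p) \<subseteq> X"
proof -
  have "\<exists>p. awalk a p b \<and> set (pawalk_verts a p) \<subseteq> X"
    using assms
  proof (induction rule: converse_rtrancl_induct)
    case base
    then show ?case
      by (intro exI[of _ "[]"]) (auto simp: awalk_Nil_iff)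
  next
    case (step a z)
    then obtain p where "awalk z p b" "set (pawalk_verts z p) \<subseteq> X"
      using in_arcsD2 by blast
    then show ?case
      using step by (intro exI[of _ "(a, z) # p"]) (auto simp: awalk_Cons_iff)
  qed
  then obtain p where p: "awalk a p b" "set (pawalk_verts a p) \<subseteq> X"
    by blast
  have "set (pawalk_verts a (awalk_to_apath p)) \<subseteq> set (pawalk_verts a p)"
    using awalk_to_apath_subset[OF p(1)]
    unfolding set_awalk_verts[OF p(1)]
      set_awalk_verts[OF awalkI_apath[OF apath_awalk_to_apath[OF p(1)]]]
    by auto
  then show ?thesis
    using apath_awalk_to_apath[OF p(1)] p(2) by blast
qed

lemma apath_split:
  assumes "apath a p b" and "z \<in> set (pawalk_verts a p)"
  shows "\<exists>p1 p2. p = p1 @ p2 \<and> apath a p1 z \<and> apath z p2 b"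
proof -
  obtain p1 p2 where p: "p = p1 @ p2" "awalk a p1 z" "awalk z p2 b"
    using awalk_decomp[of a p b z] assms by (auto simp: apath_def)
  then show ?thesis
    using assms(1) by (auto simp: apath_append_iff)
qed

lemma pawalk_verts_snoc: "awalk a p b \<Longrightarrow> pawalk_verts a p = map fst p @ [b]"
  by (induction p arbitrary: a) (auto simp: awalk_simps)

lemma pawalk_verts_Cons: "awalk a p b \<Longrightarrow> pawalk_verts a p = a # map snd p"
  by (induction p arbitrary: a) (auto simp: awalk_simps)

text \<open>\<open>cycle\<close> asks that the heads of the arcs be distinct. The vertices of a
  closed walk are both \<open>u # map snd p\<close> and \<open>map fst p @ [u]\<close>, so heads and
  tails form the same multiset.\<close>

lemma cycle_iff_distinct_tails:
  "cycle p \<longleftrightarrow> (\<exists>u. awalk u p u \<and> distinct (map fst p) \<and> p \<noteq> [])"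
proof -
  have "distinct (map snd p) \<longleftrightarrow> distinct (map fst p)" if "awalk u p u" for u
  proof -
    have "mset (u # map snd p) = mset (map fst p @ [u])"
      using pawalk_verts_snoc[OF that] pawalk_verts_Cons[OF that] by simp
    then have "mset (map snd p) = mset (map fst p)"
      by simp
    then show ?thesis
      by (rule mset_eq_imp_distinct_iff)
  qed
  then show ?thesis
    unfolding cycle_def by (metis list.sel(3) pawalk_verts_Cons)
qed

lemma cycle_distinct:
  assumes "cycle p"
  shows "distinct (map fst p)" "distinct (map snd p)" "fst ` set p = snd ` set p"
proof -
  obtain u where u: "awalk u p u" "distinct (tl (pawalk_verts u p))" "p \<noteq> []"
    using assms by (auto simp: cycle_def)
  show "distinct (map fst p)"
    using assms by (auto simp: cycle_iff_distinct_tails)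
  show "distinct (map snd p)"
    using u pawalk_verts_Cons by simp
  have "mset (u # map snd p) = mset (map fst p @ [u])"
    using pawalk_verts_snoc[OF u(1)] pawalk_verts_Cons[OF u(1)] by simp
  then have "mset (map snd p) = mset (map fst p)"
    by simp
  then show "fst ` set p = snd ` set p"
    by (metis list.set_map set_mset_mset)
qed

text \<open>Rotate the closed walk to start right after \<open>(x, y)\<close> and drop that arc. It
  does not recur in the rest, since tails are distinct.\<close>

lemma cycle_open:
  assumes "cycle p" and "(x, y) \<in> set p"
  obtains q where "apath y q x" and "set p = insert (x, y) (set q)" and "(x, y) \<notin> set q"
    and "length p = Suc (length q)" and "set (pawalk_verts y q) = fst ` set p"
proof -
  obtain u where u: "awalk u p u"
    using assms(1) by (auto simp: cycle_def)
  obtain p1 p2 where p: "p = p1 @ (x, y) # p2"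
    using assms(2) by (meson split_list)
  have d: "distinct (map fst p)"
    using cycle_distinct(1)[OF assms(1)] .
  have "awalk u p1 x" "awalk y p2 u"
    using u unfolding p by (auto simp: awalk_Cons_iff)
  then have w: "awalk y (p2 @ p1) x"
    by (rule awalk_appendI[rotated])
  have v: "pawalk_verts y (p2 @ p1) = map fst (p2 @ p1) @ [x]"
    by (rule pawalk_verts_snoc[OF w])
  show thesis
  proof
    show "apath y (p2 @ p1) x"
      unfolding apath_def using w v d p by auto
    show "set (pawalk_verts y (p2 @ p1)) = fst ` set p"
      unfolding v p by auto
    show "(x, y) \<notin> set (p2 @ p1)"
      using d unfolding p by force
  qed (auto simp: p)
qed

text \<open>A path leaves \<open>a\<close> only by its first arc, and having reached its end
  \<open>b\<close> it must stop.\<close>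

lemma apath_arc_ends:
  assumes "apath a p b" and "(a, b) \<in> set p"
  shows "p = [(a, b)]"
proof (cases p)
  case (Cons e q)
  have d: "a \<notin> set (pawalk_verts (snd e) q)" "apath (snd e) q b" "fst e = a"
    using assms(1) unfolding Cons by (auto simp: apath_Cons_iff)
  then have "(a, b) \<notin> set q"
    using awalk_verts_arc1[of "(a, b)" q "snd e"] by auto
  then have "e = (a, b)"
    using assms(2) Cons by auto
  then show ?thesis
    using d(2) apath_nonempty_ends[of b q b] Cons by auto
qed (use assms in auto)

text \<open>The tails of \<open>p\<close> omit \<open>b\<close> and those of \<open>q\<close> omit
  \<open>a\<close>, so no tail repeats. The closed walk \<open>a, b, a\<close> is still possible
  here; the length has to be checked separately.\<close>

lemma cycle_append:
  assumes p: "apath a p b" and q: "apath b q a" and "a \<noteq> b"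
    and "set (pawalk_verts a p) \<inter> set (pawalk_verts b q) \<subseteq> {a, b}"
  shows "cycle (p @ q)"
proof -
  have w: "awalk a p b" "awalk b q a"
    using p q by (auto simp: apath_def)
  note v = pawalk_verts_snoc[OF w(1)] pawalk_verts_snoc[OF w(2)]
  have "distinct (map fst p @ [b])" "distinct (map fst q @ [a])"
    using p q unfolding apath_def v by auto
  moreover have "set (map fst p @ [b]) \<inter> set (map fst q @ [a]) \<subseteq> {a, b}"
    using assms(4) unfolding v .
  ultimately have "distinct (map fst (p @ q))"
    by auto
  moreover have "p @ q \<noteq> []"
    using w \<open>a \<noteq> b\<close> by (auto simp: awalk_Nil_iff)
  ultimately show ?thesis
    using awalk_appendI[OF w] cycle_iff_distinct_tails by blast
qed

end

text \<open>Weak convexity need not pass between G and G - e, as distances may change. Connectedness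
  does pass from G - e to G.\<close>

lemma weakly_convex_imp_connected_in:
  assumes "weakly_convex G X" and "pair_wf_digraph G"
  shows "connected_in (parcs G) X"
proof -
  interpret pair_wf_digraph G by fact
  show ?thesis
    unfolding connected_in_def
  proof (intro ballI)
    fix a b assume "a \<in> X" "b \<in> X"
    then obtain p where "apath a p b" "set (pawalk_verts a p) \<subseteq> X"
      using assms(1) unfolding weakly_convex_def shortest_path_def by blast
    then show "(a, b) \<in> (parcs G \<inter> X \<times> X)\<^sup>*"
      by (intro rtrancl_restrict_awalk[of a p b]) (auto simp: apath_def)
  qed
qed

section \<open>Graphs with a single cycle\<close>

text \<open>The walk \<open>c\<close> is one representative of the cycle. Uniqueness is up to vertex
  set and symmetrised arcs, as rotations and reversals of \<open>c\<close> are cycles too.\<close>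

locale unicyclic_pair_graph = pair_graph +
  fixes c :: "('a \<times> 'a) list"
  assumes cycle: "cycle c" and length_cycle: "3 \<le> length c"
    and cycle_unique: "\<And>c'. cycle c' \<Longrightarrow> 3 \<le> length c' \<Longrightarrow>
      fst ` set c' = fst ` set c \<and> (set c')\<^sup>s = (set c)\<^sup>s"
begin

abbreviation cycle_verts :: "'a set" where
  "cycle_verts \<equiv> fst ` set c"

lemma sym_parcs: "sym (parcs G)"
  using arcs_symmetric by (auto simp: sym_def)

lemma arcs_cycle: "set c \<subseteq> parcs G"
  using cycle by (auto simp: cycle_def awalk_def)

lemma cycle_verts_subset: "cycle_verts \<subseteq> pverts G"
  using arcs_cycle arc_fst_in_verts by blast

text \<open>A chord and a stretch of the cycle between its ends would form a cycle containing the
  chord, contrary to uniqueness.\<close>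

lemma cycle_chordless:
  assumes "x \<in> cycle_verts" and "y \<in> cycle_verts" and "(x, y) \<in> parcs G"
  shows "(x, y) \<in> (set c)\<^sup>s"
proof (rule ccontr)
  assume n: "(x, y) \<notin> (set c)\<^sup>s"
  \<comment> \<open>Opening the cycle at the arc that enters \<open>x\<close> gives a path that
    starts at \<open>x\<close>; its initial piece up to \<open>y\<close> is closed by the
    chord.\<close>
  have "x \<in> snd ` set c"
    using assms(1) cycle_distinct(3)[OF cycle] by simp
  then obtain w where "(w, x) \<in> set c"
    by auto
  then obtain q where q: "apath x q w" "set c = insert (w, x) (set q)"
      "set (pawalk_verts x q) = cycle_verts"
    using cycle_open[OF cycle] by metis
  then obtain q1 q2 where q1: "q = q1 @ q2" "apath x q1 y"
    using apath_split[OF q(1)] assms(2) by blast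
  have "x \<noteq> y"
    using assms(3) no_loops' by blast
  have yx: "(y, x) \<in> parcs G"
    using assms(3) arcs_symmetric by blast
  have "apath y [(y, x)] x"
    using yx \<open>x \<noteq> y\<close> by (auto simp: apath_simps dest: in_arcsD2)
  then have cyc: "cycle (q1 @ [(y, x)])"
    using q1(2) \<open>x \<noteq> y\<close> by (intro cycle_append[of x q1 y]) auto
  have "q1 \<noteq> []"
    using q1(2) \<open>x \<noteq> y\<close> by (auto simp: apath_simps)
  \<comment> \<open>If this piece were a single arc, \<open>(x, y)\<close> itself would belong to
    \<open>c\<close>.\<close>
  moreover have "length q1 \<noteq> 1"
  proof
    assume "length q1 = 1"
    then obtain f where "q1 = [f]"
      by (auto simp: length_Suc_conv)
    then have "q1 = [(x, y)]"
      using q1(2) by (cases f) (auto simp: apath_simps)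
    then show False
      using n q q1(1) by (auto simp: symcl_def)
  qed
  ultimately have "3 \<le> length (q1 @ [(y, x)])"
    by (cases q1 rule: list_exhaust_NSC) auto
  then have "(set (q1 @ [(y, x)]))\<^sup>s = (set c)\<^sup>s"
    using cycle_unique cyc by blast
  then show False
    using n by (auto simp: symcl_def)
qed

lemma connected_in_cycle_delete:
  assumes "(u, v) \<in> set c"
  shows "connected_in (parcs (delete_edge G (u, v))) cycle_verts"
proof (rule connected_inI_base)
  let ?R = "parcs (delete_edge G (u, v))"
  show "sym ?R"
    using sym_parcs by (auto simp: delete_edge_def sym_def)
  obtain q where q: "apath v q u" "set c = insert (u, v) (set q)" "(u, v) \<notin> set q"
      "length c = Suc (length q)" "set (pawalk_verts v q) = cycle_verts"
    using cycle_open[OF cycle assms] by metis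
  \<comment> \<open>Otherwise \<open>q\<close> would be this arc alone and \<open>c\<close> would
    have length 2. So \<open>q\<close> avoids both arcs of the deleted edge.\<close>
  have "(v, u) \<notin> set q"
    using apath_arc_ends[OF q(1)] q(4) length_cycle by auto
  then have qR: "set q \<subseteq> ?R"
    using q(2,3) arcs_cycle by (auto simp: delete_edge_def)
  fix a assume "a \<in> cycle_verts"
  then obtain q1 q2 where q12: "q = q1 @ q2" "apath v q1 a" "apath a q2 u"
    using apath_split[OF q(1)] q(5) by blast
  have "set (pawalk_verts v q1) \<subseteq> cycle_verts"
    using set_awalk_verts_append[of v q1 a q2 u] q12 q(5) by (auto simp: apath_def)
  then show "(v, a) \<in> (?R \<inter> cycle_verts \<times> cycle_verts)\<^sup>*"
    using q12 qR by (intro rtrancl_restrict_awalk[of v q1 a]) (auto simp: apath_def)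
qed

lemma connected_in_cycle: "connected_in (parcs G) cycle_verts"
proof -
  obtain u v where "(u, v) \<in> set c"
    using length_cycle by (cases c) auto
  then show ?thesis
    using connected_in_cycle_delete parcs_delete_edge by (blast intro: connected_in_mono)
qed

text \<open>The deleted edge is replaced by the detour along the rest of the cycle, which lies in
  \<open>X\<close>.\<close>

lemma connected_in_delete:
  assumes "(u, v) \<in> set c" and "connected_in (parcs G) X" and "cycle_verts \<subseteq> X"
  shows "connected_in (parcs (delete_edge G (u, v))) X"
proof -
  let ?R = "parcs (delete_edge G (u, v))"
  have uv: "u \<in> cycle_verts" "v \<in> cycle_verts"
    using assms(1) cycle_distinct(3)[OF cycle] by force+
  have C: "(a, b) \<in> (?R \<inter> X \<times> X)\<^sup>*" if "a \<in> cycle_verts" "b \<in> cycle_verts" for a b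
    by (rule rtrancl_restrict_mono[OF
          connected_inD[OF connected_in_cycle_delete[OF assms(1)] that]]) (use assms(3) in auto)
  have "parcs G \<inter> X \<times> X \<subseteq> (?R \<inter> X \<times> X)\<^sup>*"
  proof
    fix f assume f: "f \<in> parcs G \<inter> X \<times> X"
    show "f \<in> (?R \<inter> X \<times> X)\<^sup>*"
    proof (cases "f \<in> {(u, v), (v, u)}")
      case True
      then show ?thesis
        using C uv by auto
    next
      case False
      then show ?thesis
        using f by (auto simp: delete_edge_def)
    qed
  qed
  then have "(parcs G \<inter> X \<times> X)\<^sup>* \<subseteq> (?R \<inter> X \<times> X)\<^sup>*"
    by (simp add: rtrancl_subset_rtrancl)
  then show ?thesis
    using assms(2) unfolding connected_in_def by blast
qed

text \<open>
  A path leaving \<open>X\<close> and coming back closes up, through \<open>X\<close>, to a cycle with a vertex outside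
  \<open>X\<close>, hence to a second cycle.
\<close>

lemma apath_in_connected:
  assumes X: "connected_in (parcs G) X" "cycle_verts \<subseteq> X"
    and "apath a p b" and "a \<in> X" and "b \<in> X"
  shows "set (pawalk_verts a p) \<subseteq> X"
  using assms(3-5)
proof (induction "length p" arbitrary: a p b rule: less_induct)
  case less
  have w: "awalk a p b"
    using less.prems by (simp add: apath_def)
  show ?case
  \<comment> \<open>An interior vertex in \<open>X\<close> splits the path into two shorter ones, to
    which the induction applies. Otherwise only the ends of the path lie in
    \<open>X\<close>.\<close>
  proof (cases "\<exists>z \<in> set (pawalk_verts a p) \<inter> X. z \<noteq> a \<and> z \<noteq> b")
    case True
    then obtain z where z: "z \<in> set (pawalk_verts a p)" "z \<in> X" "z \<noteq> a" "z \<noteq> b"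
      by blast
    then obtain p1 p2 where p: "p = p1 @ p2" "apath a p1 z" "apath z p2 b"
      using apath_split less.prems(1) by blast
    then have ne: "p1 \<noteq> []" "p2 \<noteq> []"
      using z by (auto simp: apath_simps)
    have "set (pawalk_verts a p1) \<subseteq> X" "set (pawalk_verts z p2) \<subseteq> X"
      by (rule less.hyps; use p ne z less.prems in simp)+
    then show ?thesis
      using p set_awalk_verts_append[of a p1 z p2 b] by (auto simp: apath_def)
  next
    case False
    show ?thesis
    proof
      fix y assume y: "y \<in> set (pawalk_verts a p)"
      show "y \<in> X"
      proof (rule ccontr)
        assume "y \<notin> X"
        then have y': "y \<noteq> a" "y \<noteq> b"
          using less.prems by auto
        then obtain p1 p2 where p: "p = p1 @ p2" "apath a p1 y" "apath y p2 b"
          using apath_split less.prems(1) y by blast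
        then have ne: "p1 \<noteq> []" "p2 \<noteq> []"
          using y' by (auto simp: apath_simps)
        then have len: "2 \<le> length p"
          using p(1) by (cases p1; cases p2) auto
        then have "p \<noteq> []"
          by auto
        then have ab: "a \<noteq> b"
          using apath_nonempty_ends less.prems(1) by blast
        \<comment> \<open>\<open>q\<close> returns inside \<open>X\<close> and so meets
          \<open>p\<close> only in \<open>a\<close> and \<open>b\<close>. As \<open>y\<close> is
          interior, \<open>p\<close> has at least two arcs, and the cycle \<open>p @ q\<close> has
          at least three.\<close>
        obtain q where q: "apath b q a" "set (pawalk_verts b q) \<subseteq> X"
          using ex_apath_restrict[OF connected_inD[OF X(1) less.prems(3,2)] less.prems(3)] w
          by (auto dest: awalk_last_in_verts)
        have "q \<noteq> []"
          using q(1) ab by (auto simp: apath_simps)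
        have "cycle (p @ q)"
          using less.prems(1) q(1) ab by (rule cycle_append) (use q(2) False in auto)
        moreover have "3 \<le> length (p @ q)"
          using len \<open>q \<noteq> []\<close> by (cases q) auto
        ultimately have "fst ` set (p @ q) \<subseteq> X"
          using cycle_unique X(2) by blast
        moreover have "y \<in> fst ` set p"
          using y y' pawalk_verts_snoc[OF w] by auto
        ultimately show False
          using \<open>y \<notin> X\<close> by auto
      qed
    qed
  qed
qed

text \<open>Paths of \<open>H\<close> are paths of G, so all of them between vertices of
  \<open>X\<close> stay in \<open>X\<close>, in particular the shortest. Connectedness in
  \<open>H\<close> ensures that one exists.\<close>

lemma connected_in_imp_weakly_convex:
  assumes X: "connected_in (parcs G) X" "cycle_verts \<subseteq> X" "X \<subseteq> pverts G"
    and H: "pair_wf_digraph H" "pverts H = pverts G" "parcs H \<subseteq> parcs G" "connected_in (parcs H) X"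
  shows "weakly_convex H X"
  unfolding weakly_convex_def
proof (intro conjI ballI)
  interpret H: pair_wf_digraph H by fact
  show "X \<subseteq> pverts H"
    using X H by simp
  fix a b assume ab: "a \<in> X" "b \<in> X"
  have "\<exists>p. H.apath a p b"
    using H.ex_apath_restrict[OF connected_inD[OF H(4) ab] ab(1)] ab X(3) H(2) by auto
  then obtain p where p: "H.apath a p b" "\<And>q. H.apath a q b \<Longrightarrow> length p \<le> length q"
    using ex_has_least_nat[of "\<lambda>p. H.apath a p b" _ length] by blast
  have "apath a p b"
    using p(1) H unfolding H.apath_def H.awalk_def apath_def awalk_def by auto
  then have "set (pawalk_verts a p) \<subseteq> X"
    using apath_in_connected X ab by blast
  then show "\<exists>p. shortest_path H a p b \<and> set (pawalk_verts a p) \<subseteq> X"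
    unfolding shortest_path_def using p by blast
qed

section \<open>Cycle vertices missing from a connected dominating set\<close>

lemma card_cycle_verts_diff:
  assumes D: "connected_in (parcs G) D" "dominating G D"
  shows "card (cycle_verts - D) \<le> 2"
proof (cases "card (cycle_verts - D) \<le> 1")
  case False
  let ?S = "cycle_verts - D"
  let ?X = "D \<inter> cycle_verts"
  have DG: "D \<subseteq> pverts G"
    using D(2) by (simp add: dominating_def)
  have path: "\<exists>p. apath a p b \<and> set (pawalk_verts a p) \<subseteq> D" if "a \<in> D" "b \<in> D" for a b
    using ex_apath_restrict[OF connected_inD[OF D(1) that]] that DG by blast
  have nb: "\<exists>d \<in> D. (w, d) \<in> parcs G" if "w \<in> ?S" for w
    using that D(2) cycle_verts_subset by (auto simp: dominating_def)
  \<comment> \<open>A missing vertex could be dominated from off the cycle. With two missing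
    vertices this is impossible: going from \<open>w\<close> to its dominator \<open>d\<close>,
    through \<open>D\<close> to \<open>d'\<close> and on to \<open>w'\<close> is a path between
    cycle vertices, so it stays on the cycle.\<close>
  have nbX: "\<exists>d \<in> ?X. (w, d) \<in> parcs G" if w: "w \<in> ?S" for w
  proof -
    obtain w' where w': "w' \<in> ?S" "w' \<noteq> w"
      using False w by (metis card_1_singleton_iff card_le_Suc0_iff_eq finite_Diff finite_imageI
          finite_set nat_le_linear One_nat_def le_SucE)
    obtain d d' where d: "d \<in> D" "(w, d) \<in> parcs G" "d' \<in> D" "(w', d') \<in> parcs G"
      using nb w w' by blast
    obtain p where p: "apath d p d'" "set (pawalk_verts d p) \<subseteq> D"
      using path d by blast
    have d'w': "(d', w') \<in> parcs G"
      using d(4) arcs_symmetric by blast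
    have "w \<notin> set (pawalk_verts d p)" "w' \<notin> set (pawalk_verts d p)"
      using p(2) w w' by auto
    moreover have "apath d' [(d', w')] w'"
      using d'w' no_loops' by (auto simp: apath_simps dest: in_arcsD2)
    ultimately have dp: "apath d (p @ [(d', w')]) w'"
      using p(1) awlast_of_awalk[OF awalkI_apath[OF p(1)]] by (simp add: apath_append_iff)
    have v: "set (pawalk_verts d (p @ [(d', w')])) = set (pawalk_verts d p) \<union> {d', w'}"
      using set_awalk_verts_append[of d p d' "[(d', w')]" w'] p(1) \<open>apath d' [(d', w')] w'\<close>
      by (auto simp: apath_def)
    have "apath w ((w, d) # p @ [(d', w')]) w'"
      using dp d(1,2,3) v w w' p(2) by (auto simp: apath_Cons_iff)
    then have "set (pawalk_verts w ((w, d) # p @ [(d', w')])) \<subseteq> cycle_verts"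
      using w w' by (intro apath_in_connected[OF connected_in_cycle]) auto
    moreover have "d \<in> set (pawalk_verts d (p @ [(d', w')]))"
      by (rule hd_in_awalk_verts(2)[OF dp])
    ultimately show ?thesis
      using d by auto
  qed
  \<comment> \<open>A path within \<open>D\<close> between two cycle vertices also stays within the
    cycle, since \<open>cycle_verts\<close> is itself a connected set containing the cycle.\<close>
  have "connected_in (parcs G) ?X"
    unfolding connected_in_def
  proof (intro ballI)
    fix a b assume ab: "a \<in> ?X" "b \<in> ?X"
    then obtain p where p: "apath a p b" "set (pawalk_verts a p) \<subseteq> D"
      using path by blast
    moreover have "set (pawalk_verts a p) \<subseteq> cycle_verts"
      using ab p(1) by (intro apath_in_connected[OF connected_in_cycle]) auto
    ultimately show "(a, b) \<in> (parcs G \<inter> ?X \<times> ?X)\<^sup>*"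
      by (intro rtrancl_restrict_awalk[of a p b]) (auto simp: apath_def)
  qed
  then have conn: "connected_in ((set c)\<^sup>s) ?X"
    by (rule connected_in_mono) (use cycle_chordless in blast)
  \<comment> \<open>Distinct tails and distinct heads: each cycle vertex has one successor and one
    predecessor along \<open>c\<close>.\<close>
  have sv: "single_valued (set c)" "single_valued ((set c)\<inverse>)"
    using cycle_distinct(1,2)[OF cycle]
    by (fastforce simp: single_valued_def distinct_map inj_on_def)+
  \<comment> \<open>The vertices reached on leaving \<open>?X\<close> by one arc of
    \<open>r\<close>. Taking \<open>r\<close> as \<open>set c\<close> and as its converse covers the
    two directions around the cycle, and \<open>exit_unique\<close> allows one such vertex in
    each.\<close>
  let ?F = "\<lambda>r. {w. w \<notin> ?X \<and> (\<exists>x \<in> ?X. (x, w) \<in> r)}"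
  have F: "finite (?F r) \<and> card (?F r) \<le> 1" if "r = set c \<or> r = (set c)\<inverse>" for r
  proof -
    have r: "single_valued r" "single_valued (r\<inverse>)" "connected_in (r\<^sup>s) ?X"
      using that sv conn by (auto simp: symcl_converse)
    have "?F r \<subseteq> snd ` r"
      by force
    moreover have "finite (snd ` r)"
      using that by auto
    ultimately have "finite (?F r)"
      by (rule finite_subset)
    moreover have "\<forall>w \<in> ?F r. \<forall>w' \<in> ?F r. w = w'"
      using exit_unique[OF r] by blast
    ultimately show ?thesis
      using card_le_Suc0_iff_eq unfolding One_nat_def by blast
  qed
  have "?S \<subseteq> ?F (set c) \<union> ?F ((set c)\<inverse>)"
  proof
    fix w assume w: "w \<in> ?S"
    then obtain d where d: "d \<in> ?X" "(w, d) \<in> parcs G"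
      using nbX by blast
    then have "(w, d) \<in> (set c)\<^sup>s"
      using cycle_chordless w by blast
    then show "w \<in> ?F (set c) \<union> ?F ((set c)\<inverse>)"
      using d w by (auto simp: symcl_def)
  qed
  then have "card ?S \<le> card (?F (set c) \<union> ?F ((set c)\<inverse>))"
    using F by (intro card_mono finite_UnI) blast+
  also have "\<dots> \<le> card (?F (set c)) + card (?F ((set c)\<inverse>))"
    by (rule card_Un_le)
  also have "\<dots> \<le> 2"
    using F[of "set c"] F[of "(set c)\<inverse>"] by simp
  finally show ?thesis .
qed simp

text \<open>A cycle vertex missing from \<open>D\<close> has a neighbour in \<open>D\<close>, and
  this edge links the two connected sets.\<close>

lemma connected_in_Un_cycle:
  assumes D: "connected_in (parcs G) D" "dominating G D"
  shows "connected_in (parcs G) (D \<union> cycle_verts)"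
proof (cases "cycle_verts \<subseteq> D")
  case True
  then show ?thesis
    using D(1) by (simp add: Un_absorb2)
next
  case False
  then obtain w where w: "w \<in> cycle_verts" "w \<notin> D"
    by blast
  then obtain d where "d \<in> D" "(w, d) \<in> parcs G"
    using D(2) cycle_verts_subset unfolding dominating_def by blast
  then show ?thesis
    using connected_in_Un[OF sym_parcs connected_in_cycle D(1) w(1)] by (simp add: Un_commute)
qed

end

section \<open>Comparing the two domination numbers\<close>

lemma gamma_wcon_le:
  "weakly_convex H X \<Longrightarrow> dominating H X \<Longrightarrow> \<gamma>\<^sub>w\<^sub>c\<^sub>o\<^sub>n H \<le> card X"
  unfolding gamma_wcon_def by (rule Least_le) blast

lemma gamma_wcon_attained:
  assumes "weakly_convex H X" and "dominating H X"
  obtains D where "weakly_convex H D" "dominating H D" "card D = \<gamma>\<^sub>w\<^sub>c\<^sub>o\<^sub>n H"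
proof -
  have "\<exists>D. weakly_convex H D \<and> dominating H D \<and> card D = \<gamma>\<^sub>w\<^sub>c\<^sub>o\<^sub>n H"
    unfolding gamma_wcon_def by (rule LeastI_ex) (use assms in blast)
  then show thesis
    using that by blast
qed

text \<open>\<open>H\<close> and \<open>H'\<close> range over both graphs so that one argument gives
  both inequalities.\<close>

lemma (in unicyclic_pair_graph) gamma_wcon_delete_edge:
  assumes conn: "connected_in (parcs G) (pverts G)" and uv: "(u, v) \<in> set c"
    and HH': "H \<in> {G, delete_edge G (u, v)}" "H' \<in> {G, delete_edge G (u, v)}"
  shows "\<gamma>\<^sub>w\<^sub>c\<^sub>o\<^sub>n H' \<le> \<gamma>\<^sub>w\<^sub>c\<^sub>o\<^sub>n H + 2"
proof -
  have sub: "pair_wf_digraph K" "pverts K = pverts G" "parcs K \<subseteq> parcs G"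
      and arcs: "parcs G - {(u, v), (v, u)} \<subseteq> parcs K"
    if "K \<in> {G, delete_edge G (u, v)}" for K
    using that pair_wf_digraph arc_fst_in_verts arc_snd_in_verts
    by (auto simp: delete_edge_def pair_wf_digraph_def dest: in_arcsD1 in_arcsD2)
  have uv': "u \<in> cycle_verts" "v \<in> cycle_verts"
    using uv cycle_distinct(3)[OF cycle] by force+
  have wc: "weakly_convex K X" "dominating K X"
    if K: "K \<in> {G, delete_edge G (u, v)}" and X: "connected_in (parcs G) X" "cycle_verts \<subseteq> X"
      "dominating G X" for K X
  proof -
    have "X \<subseteq> pverts G"
      using X(3) by (simp add: dominating_def)
    moreover have "connected_in (parcs K) X"
      using K X(1,2) connected_in_delete[OF uv] by auto
    ultimately show "weakly_convex K X"
      using connected_in_imp_weakly_convex[OF X(1,2)] sub[OF K] by blast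
    \<comment> \<open>Both ends of the deleted edge lie in \<open>X\<close>, so no arc out of a
      vertex outside \<open>X\<close> is lost.\<close>
    have "(x, d) \<in> parcs K" if "x \<notin> X" "(x, d) \<in> parcs G" for x d
      using arcs[OF K] that uv' X(2) by auto
    then show "dominating K X"
      using X(3) sub(2)[OF K] unfolding dominating_def by (metis DiffD2)
  qed
  \<comment> \<open>The whole vertex set shows that the minimum defining \<open>gamma_wcon\<close>
    for \<open>H\<close> is attained.\<close>
  have "weakly_convex H (pverts G)" "dominating H (pverts G)"
    by (rule wc[OF HH'(1) conn cycle_verts_subset]; simp add: dominating_def)+
  then obtain D where D: "weakly_convex H D" "dominating H D" "card D = \<gamma>\<^sub>w\<^sub>c\<^sub>o\<^sub>n H"
    by (rule gamma_wcon_attained)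
  have "connected_in (parcs G) D"
    using weakly_convex_imp_connected_in[OF D(1) sub(1)[OF HH'(1)]] sub(3)[OF HH'(1)]
    by (blast intro: connected_in_mono)
  moreover have dom: "dominating G D"
    using D(2) sub(2,3)[OF HH'(1)] unfolding dominating_def by fastforce
  ultimately have X: "connected_in (parcs G) (D \<union> cycle_verts)" "card (cycle_verts - D) \<le> 2"
    using connected_in_Un_cycle card_cycle_verts_diff by auto
  have "dominating G (D \<union> cycle_verts)"
    using dom cycle_verts_subset unfolding dominating_def by blast
  then have "\<gamma>\<^sub>w\<^sub>c\<^sub>o\<^sub>n H' \<le> card (D \<union> cycle_verts)"
    using wc[OF HH'(2) X(1)] gamma_wcon_le by blast
  also have "\<dots> = card (D \<union> (cycle_verts - D))"
    by simp
  also have "\<dots> \<le> card D + card (cycle_verts - D)"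
    by (rule card_Un_le)
  finally show ?thesis
    using X(2) D(3) by linarith
qed

theorem theorem4p7:
  fixes G C :: "'a pair_pre_digraph" and e :: "'a \<times> 'a"
  assumes "pair_graph G"
    and "unicyclic G"
    and "cycle_of G C"
    and "e \<in> parcs C"
  shows "int (\<gamma>\<^sub>w\<^sub>c\<^sub>o\<^sub>n G) - 2 \<le> int (\<gamma>\<^sub>w\<^sub>c\<^sub>o\<^sub>n (delete_edge G e))
       \<and> int (\<gamma>\<^sub>w\<^sub>c\<^sub>o\<^sub>n (delete_edge G e)) \<le> int (\<gamma>\<^sub>w\<^sub>c\<^sub>o\<^sub>n G) + 2"
proof -
  interpret pair_graph G by fact
  obtain c where c: "cycle c" "3 \<le> length c" "C = \<lparr> pverts = fst ` set c, parcs = (set c)\<^sup>s \<rparr>"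
    using assms(3) by (auto simp: cycle_of_def)
  have "C' = C" if "cycle_of G C'" for C'
    using assms(2,3) that by (auto simp: unicyclic_def)
  then have "\<lparr> pverts = fst ` set c', parcs = (set c')\<^sup>s \<rparr> = C" if "cycle c'" "3 \<le> length c'" for c'
    using that unfolding cycle_of_def by blast
  then have "fst ` set c' = fst ` set c \<and> (set c')\<^sup>s = (set c)\<^sup>s"
    if "cycle c'" "3 \<le> length c'" for c'
    using that unfolding c(3) by simp
  then interpret unicyclic_pair_graph G c
    using c(1,2) by unfold_locales
  \<comment> \<open>\<open>connected\<close> is defined through the symmetric closure; for a
    symmetric digraph this yields directed walks between all vertices.\<close>
  have "strongly_connected (with_proj G)"
    using assms(2) symmetric_connected_imp_strongly_connected[OF sym_arcs]
    by (simp add: unicyclic_def)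
  have conn: "connected_in (parcs G) (pverts G)"
    unfolding connected_in_def
  proof (intro ballI)
    fix a b assume "a \<in> pverts G" "b \<in> pverts G"
    then have "a \<rightarrow>\<^sup>*\<^bsub>with_proj G\<^esub> b"
      using \<open>strongly_connected (with_proj G)\<close> by (auto simp: strongly_connected_def)
    then obtain p where p: "awalk a p b"
      using reachable_awalk by blast
    then show "(a, b) \<in> (parcs G \<inter> pverts G \<times> pverts G)\<^sup>*"
      by (intro rtrancl_restrict_awalk[OF p]) auto
  qed
  \<comment> \<open>\<open>e\<close> may run against the orientation of \<open>c\<close>; as an
    undirected edge it is the same after swapping.\<close>
  obtain u v where uv: "(u, v) \<in> set c" "delete_edge G e = delete_edge G (u, v)"
    using assms(4) c(3) delete_edge_swap[of G] by (cases e) (auto simp: symcl_def)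
  show ?thesis
    using gamma_wcon_delete_edge[OF conn uv(1), of G "delete_edge G (u, v)"]
      gamma_wcon_delete_edge[OF conn uv(1), of "delete_edge G (u, v)" G]
    unfolding uv(2) by simp
qed

end
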